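(* Let $A,T\in\mathbb{B}(\mathcal{H})$ be transloid operators. Then for any $P\in\mathcal{S}(\mathcal{H})$, $$|tr(PAT)-tr(PA)tr(PT)|\le \sup_{\widetilde P\in\mathcal{S}(\mathcal{H})}|tr(\widetilde PAT)-tr(\widetilde PA)tr(\widetilde PT)|\le dist(A,\mathbb{C}Id)\,dist(T,\mathbb{C}Id)=r_Ar_T.$$
   Context: $\mathcal{H}$ is a complex separable Hilbert space, $\mathbb{B}(\mathcal{H})$ is the algebra of bounded linear operators on $\mathcal{H}$ with operator norm $\|\cdot\|$, and $Id$ is the identity operator. $\mathcal{S}(\mathcal{H})$ denotes the set of density operators (states): positive trace class operators $P$ with $tr(P)=1$. For $S\in\mathbb{B}(\mathcal{H})$: $r(S)=\sup\{|z|:z\in\sigma(S)\}$ is the spectral radius, $w(S)=\sup\{|\langle Sh,h\rangle|:\|h\|=1\}$ is the numerical radius, and $dist(S,\mathbb{C}Id)=\inf_{z\in\mathbb{C}}\|S-zId\|$. $S$ is called normaloid if $r(S)=\|S\|=w(S)$, and transloid if $S-\mu Id$ is normaloid for all $\mu\in\mathbb{C}$. $r_S$ (not to be confused with $r(S)$) denotes the radius of the unique smallest disc containing the spectrum $\sigma(S)$. *)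

theory Defs
  imports "HOL-Analysis.Analysis"
begin

(* The inner product is linear in its first argument and conjugate-linear in its second. *)

class complex_inner = real_normed_vector +
  fixes scaleC :: "complex \<Rightarrow> 'a \<Rightarrow> 'a"  (infixr "*\<^sub>C" 75)
    and cinner :: "'a \<Rightarrow> 'a \<Rightarrow> complex"
  assumes scaleC_add_right: "z *\<^sub>C (x + y) = z *\<^sub>C x + z *\<^sub>C y"
    and scaleC_add_left: "(z + u) *\<^sub>C x = z *\<^sub>C x + u *\<^sub>C x"
    and scaleC_scaleC: "z *\<^sub>C u *\<^sub>C x = (z * u) *\<^sub>C x"
    and scaleC_one: "1 *\<^sub>C x = x"
    and scaleR_scaleC: "r *\<^sub>R x = complex_of_real r *\<^sub>C x"
    and cinner_commute: "cinner x y = cnj (cinner y x)"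
    and cinner_add_left: "cinner (x + y) v = cinner x v + cinner y v"
    and cinner_scaleC_left: "cinner (z *\<^sub>C x) y = z * cinner x y"
    and cinner_self_nonneg: "cinner x x \<in> \<real>\<^sub>\<ge>\<^sub>0"
    and cinner_self_eq_0_iff: "cinner x x = 0 \<longleftrightarrow> x = 0"
    and norm_eq_sqrt_cinner: "norm x = sqrt (Re (cinner x x))"

class chilbert_space = complex_inner + complete_space

lemma vector_space_scaleC: "vector_space (scaleC :: complex \<Rightarrow> 'a::complex_inner \<Rightarrow> 'a)"
  by unfold_locales
     (simp_all add: scaleC_add_right scaleC_add_left scaleC_scaleC scaleC_one)

lemma cinner_scaleC_right: "cinner x (z *\<^sub>C y) = cnj z * cinner x y"
  by (metis cinner_commute cinner_scaleC_left complex_cnj_mult)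

lemma norm_scaleC: "norm (z *\<^sub>C x) = cmod z * norm x"
proof -
  have "cinner (z *\<^sub>C x) (z *\<^sub>C x) = (z * cnj z) * cinner x x"
    by (simp add: cinner_scaleC_left cinner_scaleC_right)
  also have "z * cnj z = complex_of_real ((cmod z)\<^sup>2)"
    using complex_norm_square[of z] by simp
  finally have "Re (cinner (z *\<^sub>C x) (z *\<^sub>C x)) = (cmod z)\<^sup>2 * Re (cinner x x)"
    by simp
  then show ?thesis
    by (simp add: norm_eq_sqrt_cinner real_sqrt_mult)
qed

(* The type of continuous real-linear maps carries the operator norm; the algebra of
   bounded operators on the complex space consists of its complex-linear elements. *)

definition bounded_operators :: "('a::complex_inner \<Rightarrow>\<^sub>L 'a) set" where
  "bounded_operators = {S. \<forall>z x. blinfun_apply S (z *\<^sub>C x) = z *\<^sub>C S x}"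

lift_definition scalar_op :: "complex \<Rightarrow> 'a::complex_inner \<Rightarrow>\<^sub>L 'a" is "\<lambda>z x. z *\<^sub>C x"
proof -
  fix z :: complex
  show "bounded_linear (\<lambda>x::'a. z *\<^sub>C x)"
    by (rule bounded_linear_intro[where K = "cmod z"])
       (simp_all add: scaleC_add_right scaleR_scaleC scaleC_scaleC norm_scaleC mult.commute)
qed

definition spectrum :: "('a::complex_inner \<Rightarrow>\<^sub>L 'a) \<Rightarrow> complex set" where
  "spectrum S = {z. \<not> (\<exists>R\<in>bounded_operators.
     R o\<^sub>L (S - scalar_op z) = id_blinfun \<and> (S - scalar_op z) o\<^sub>L R = id_blinfun)}"

definition spectral_radius :: "('a::complex_inner \<Rightarrow>\<^sub>L 'a) \<Rightarrow> real" where
  "spectral_radius S = (SUP z\<in>spectrum S. cmod z)"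

definition numerical_radius :: "('a::complex_inner \<Rightarrow>\<^sub>L 'a) \<Rightarrow> real" where
  "numerical_radius S = (SUP h\<in>{h. norm h = 1}. cmod (cinner (S h) h))"

definition dist_scalars :: "('a::complex_inner \<Rightarrow>\<^sub>L 'a) \<Rightarrow> real" where
  "dist_scalars S = (INF z. norm (S - scalar_op z))"

definition normaloid :: "('a::complex_inner \<Rightarrow>\<^sub>L 'a) \<Rightarrow> bool" where
  "normaloid S \<longleftrightarrow> spectral_radius S = norm S \<and> norm S = numerical_radius S"

definition transloid :: "('a::complex_inner \<Rightarrow>\<^sub>L 'a) \<Rightarrow> bool" where
  "transloid S \<longleftrightarrow> (\<forall>\<mu>. normaloid (S - scalar_op \<mu>))"

(* Discs are closed; the degenerate disc of radius 0 is allowed (spectrum a single point). *)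

definition is_smallest_disc :: "complex set \<Rightarrow> complex \<Rightarrow> real \<Rightarrow> bool" where
  "is_smallest_disc X c \<rho> \<longleftrightarrow> 0 \<le> \<rho> \<and> X \<subseteq> cball c \<rho> \<and>
     (\<forall>c' \<rho>'. 0 \<le> \<rho>' \<and> X \<subseteq> cball c' \<rho>' \<longrightarrow> \<rho> \<le> \<rho>')"

definition spectral_disc_radius :: "('a::complex_inner \<Rightarrow>\<^sub>L 'a) \<Rightarrow> real" where
  "spectral_disc_radius S = (THE \<rho>. \<exists>c. is_smallest_disc (spectrum S) c \<rho>)"

definition positive_op :: "('a::complex_inner \<Rightarrow>\<^sub>L 'a) \<Rightarrow> bool" where
  "positive_op S \<longleftrightarrow> S \<in> bounded_operators \<and> (\<forall>x. cinner (S x) x \<in> \<real>\<^sub>\<ge>\<^sub>0)"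

definition cadjoint :: "('a::chilbert_space \<Rightarrow>\<^sub>L 'a) \<Rightarrow> 'a \<Rightarrow>\<^sub>L 'a" where
  "cadjoint S = (THE R. R \<in> bounded_operators \<and> (\<forall>x y. cinner (S x) y = cinner x (blinfun_apply R y)))"

definition abs_op :: "('a::chilbert_space \<Rightarrow>\<^sub>L 'a) \<Rightarrow> 'a \<Rightarrow>\<^sub>L 'a" where
  "abs_op S = (THE R. positive_op R \<and> R o\<^sub>L R = cadjoint S o\<^sub>L S)"

definition is_onb :: "'a::complex_inner set \<Rightarrow> bool" where
  "is_onb E \<longleftrightarrow> (\<forall>e\<in>E. norm e = 1) \<and> (\<forall>e\<in>E. \<forall>f\<in>E. e \<noteq> f \<longrightarrow> cinner e f = 0) \<and>
     closure (module.span (*\<^sub>C) E) = UNIV"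

definition trace_class :: "('a::chilbert_space \<Rightarrow>\<^sub>L 'a) \<Rightarrow> bool" where
  "trace_class S \<longleftrightarrow> S \<in> bounded_operators \<and>
     (\<exists>E. is_onb E \<and> (\<lambda>e. cinner (abs_op S e) e) summable_on E)"

(* For trace class operators the sum is absolutely convergent and does not depend on the
   chosen orthonormal basis. *)

definition tr :: "('a::chilbert_space \<Rightarrow>\<^sub>L 'a) \<Rightarrow> complex" where
  "tr S = (\<Sum>\<^sub>\<infinity>e\<in>(SOME E. is_onb E). cinner (S e) e)"

definition states :: "('a::chilbert_space \<Rightarrow>\<^sub>L 'a) set" where
  "states = {P. positive_op P \<and> trace_class P \<and> tr P = 1}"

end

theory Submission
  imports Defs
begin

text \<open>
  The first inequality holds because \<open>P\<close> is one of the states over which the supremum is taken.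

  For the second, a state \<open>Q\<close> is a mixture of vectors: there are \<open>g k\<close> with \<open>(\<Sum>k. \<parallel>g k\<parallel>\<^sup>2) = 1\<close> such
  that the expectation of \<open>X\<close>, the trace of the composition of \<open>Q\<close> with \<open>X\<close>, is
  \<open>(\<Sum>k. \<langle>X (g k), g k\<rangle>)\<close> for every bounded \<open>X\<close> (\<open>state_vector_decomposition\<close>). Usually \<open>g\<close> comes from the
  square root or from the spectral decomposition of \<open>Q\<close>; here it comes from a Cholesky factorization
  of \<open>Q\<close> along an orthonormal basis (\<open>psd_map_rank_one_decomposition\<close>), which uses only algebra. In terms
  of the vectors the bound is classical. Let \<open>\<tau>\<close> be the expectation of \<open>T\<close>. The covariance of \<open>A\<close>
  and \<open>T\<close> is the expectation of \<open>(A - a) (T - \<tau>)\<close>, whatever the scalar \<open>a\<close> is, and by the Cauchy--Schwarz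
  inequality it is at most \<open>\<parallel>A - a\<parallel>\<close> times the standard deviation of \<open>T\<close>, which is at most \<open>\<parallel>T - t\<parallel>\<close> for
  every scalar \<open>t\<close> (\<open>covariance_vectors_le\<close>). The best scalars \<open>a\<close> and \<open>t\<close> exist by compactness
  (\<open>dist_scalars_attained\<close>).

  The equality is where transloid operators enter. For them \<open>\<parallel>S - \<mu>\<parallel>\<close> is the supremum of the distances
  from \<open>\<mu>\<close> to the points of the spectrum, so a scalar \<open>\<mu>\<close> approximates \<open>S\<close> within \<open>\<rho>\<close> exactly if the disc about
  \<open>\<mu>\<close> with radius \<open>\<rho>\<close> contains the spectrum (\<open>norm_diff_scalar_transloid\<close>). The best scalar
  approximation is therefore the centre of a smallest disc around the spectrum, and the distance is its
  radius.
\<close>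

section \<open>Elementary facts on the inner product\<close>

lemma scaleC_zero_left [simp]: "0 *\<^sub>C x = (0::'a::complex_inner)"
  using scaleC_add_left[of 0 0 x] by simp

lemma scaleC_zero_right [simp]: "z *\<^sub>C 0 = (0::'a::complex_inner)"
  using scaleC_add_right[of z 0 "0::'a"] by simp

lemma scaleC_diff_left: "(z - u) *\<^sub>C x = z *\<^sub>C x - u *\<^sub>C x"
  using scaleC_add_left[of "z - u" u x] by simp

lemma scaleC_diff_right: "z *\<^sub>C (x - y) = z *\<^sub>C x - z *\<^sub>C y"
  using scaleC_add_right[of z "x - y" y] by simp

lemma cinner_zero_left [simp]: "cinner 0 y = 0"
  using cinner_add_left[of 0 0 y] by simp

lemma cinner_zero_right [simp]: "cinner y 0 = 0"
  by (metis cinner_commute cinner_zero_left complex_cnj_zero)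

lemma cinner_add_right: "cinner x (y + v) = cinner x y + cinner x v"
  by (metis cinner_add_left cinner_commute complex_cnj_add)

lemma cinner_diff_left: "cinner (x - y) v = cinner x v - cinner y v"
  using cinner_add_left[of "x - y" y v] by simp

lemma cinner_diff_right: "cinner v (x - y) = cinner v x - cinner v y"
  using cinner_add_right[of v "x - y" y] by simp

lemma cinner_sum_left: "cinner (\<Sum>i\<in>I. f i) y = (\<Sum>i\<in>I. cinner (f i) y)"
  by (induction I rule: infinite_finite_induct) (auto simp: cinner_add_left)

lemma cinner_sum_right: "cinner y (\<Sum>i\<in>I. f i) = (\<Sum>i\<in>I. cinner y (f i))"
  by (induction I rule: infinite_finite_induct) (auto simp: cinner_add_right)

lemma cinner_self: "cinner x x = complex_of_real ((norm x)\<^sup>2)"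
  using cinner_self_nonneg[of x]
  by (auto simp: norm_eq_sqrt_cinner complex_nonneg_Reals_iff complex_eq_iff)

lemma cinner_mult_swap: "cinner x y * cinner y x = complex_of_real ((cmod (cinner x y))\<^sup>2)"
  using complex_norm_square[of "cinner x y"] cinner_commute[of y x] by simp

lemma cmod_cinner_commute: "cmod (cinner x y) = cmod (cinner y x)"
  by (metis cinner_commute complex_mod_cnj)

section \<open>Positive semidefinite maps\<close>

text \<open>
  The predicate is about plain functions because the Schur complements below are defined as such and
  every property of them that matters is algebraic.
\<close>

definition psd_map :: "('a::complex_inner \<Rightarrow> 'a) \<Rightarrow> bool" where
  "psd_map R \<longleftrightarrow> (\<forall>x y. R (x + y) = R x + R y) \<and> (\<forall>z x. R (z *\<^sub>C x) = z *\<^sub>C R x) \<and>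
     (\<forall>x. cinner (R x) x \<in> \<real>\<^sub>\<ge>\<^sub>0)"

lemma psd_map_real:
  assumes "psd_map R"
  shows "cinner (R x) x = complex_of_real (Re (cinner (R x) x))" "0 \<le> Re (cinner (R x) x)"
proof -
  have "cinner (R x) x \<in> \<real>\<^sub>\<ge>\<^sub>0"
    using assms unfolding psd_map_def by blast
  then show "cinner (R x) x = complex_of_real (Re (cinner (R x) x))" "0 \<le> Re (cinner (R x) x)"
    by (auto simp: complex_nonneg_Reals_iff complex_eq_iff)
qed

text \<open>
  Polarization: the quadratic form takes real values at \<open>x + y\<close> and at \<open>x + \<i>y\<close>, which
  forces the imaginary and the real parts of \<open>\<langle>R x, y\<rangle>\<close> and \<open>\<langle>x, R y\<rangle>\<close> to agree.
\<close>

lemma psd_map_symmetric: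
  assumes "psd_map R"
  shows "cinner (R x) y = cinner x (R y)"
proof -
  have expand: "cinner (R (x + z *\<^sub>C y)) (x + z *\<^sub>C y) = cinner (R x) x + cnj z * cinner (R x) y
      + z * cinner (R y) x + z * cnj z * cinner (R y) y" for z
    using assms by (simp add: psd_map_def cinner_add_left cinner_add_right cinner_scaleC_left
        cinner_scaleC_right algebra_simps)
  have im: "Im (cinner (R v) v) = 0" for v
    using psd_map_real(1)[OF assms, of v] by (metis Im_complex_of_real)
  have "Im (cinner (R x) y) + Im (cinner (R y) x) = 0"
    using arg_cong[OF expand[of 1], of Im] im by simp
  moreover have "Re (cinner (R y) x) = Re (cinner (R x) y)"
    using arg_cong[OF expand[of \<i>], of Im] im by simp
  ultimately have "cinner (R x) y = cnj (cinner (R y) x)"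
    by (simp add: complex_eq_iff)
  then show ?thesis
    by (metis cinner_commute)
qed

text \<open>
  With \<open>c = \<langle>R x, y\<rangle>\<close>, the quadratic form at \<open>x + (t c) y\<close> is a real quadratic polynomial in \<open>t\<close>
  that is never negative; evaluating it at its minimum gives the inequality. If \<open>\<langle>R y, y\<rangle> = 0\<close> the
  polynomial is affine, hence constant, so \<open>c = 0\<close>.
\<close>

lemma psd_map_Cauchy_Schwarz:
  assumes "psd_map R"
  shows "(cmod (cinner (R x) y))\<^sup>2 \<le> Re (cinner (R x) x) * Re (cinner (R y) y)"
proof -
  let ?a = "Re (cinner (R x) x)" and ?b = "Re (cinner (R y) y)" and ?c = "cinner (R x) y"
  have *: "0 \<le> ?a + 2 * t * (cmod ?c)\<^sup>2 + t\<^sup>2 * (cmod ?c)\<^sup>2 * ?b" for t :: real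
  proof -
    define z where "z = complex_of_real t * ?c"
    have yx: "cinner (R y) x = cnj ?c"
      by (metis assms cinner_commute psd_map_symmetric)
    have "cinner (R (x + z *\<^sub>C y)) (x + z *\<^sub>C y) = cinner (R x) x + cnj z * ?c
      + z * cnj ?c + z * cnj z * cinner (R y) y"
      using assms by (simp add: psd_map_def cinner_add_left cinner_add_right cinner_scaleC_left
          cinner_scaleC_right algebra_simps yx[symmetric])
    also have "cnj z * ?c = complex_of_real (t * (cmod ?c)\<^sup>2)"
      by (simp only: z_def complex_cnj_mult complex_cnj_complex_of_real of_real_mult
          complex_norm_square[of ?c] mult_ac)
    also have "z * cnj ?c = complex_of_real (t * (cmod ?c)\<^sup>2)"
      by (simp only: z_def of_real_mult mult.assoc complex_norm_square[of ?c])
    also have "z * cnj z = complex_of_real (t\<^sup>2 * (cmod ?c)\<^sup>2)"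
      using complex_norm_square[of z] by (simp add: z_def norm_mult power_mult_distrib)
    finally have "Re (cinner (R (x + z *\<^sub>C y)) (x + z *\<^sub>C y)) =
        ?a + 2 * t * (cmod ?c)\<^sup>2 + t\<^sup>2 * (cmod ?c)\<^sup>2 * ?b"
      by (simp del: of_real_mult of_real_power)
    then show ?thesis
      using psd_map_real(2)[OF assms] by metis
  qed
  have a: "0 \<le> ?a" and b: "0 \<le> ?b"
    using psd_map_real(2)[OF assms] by auto
  show ?thesis
  proof (cases "?b = 0 \<or> ?c = 0")
    case True
    have "?c = 0" if "?b = 0"
    proof (rule ccontr)
      assume "?c \<noteq> 0"
      then have "0 < (cmod ?c)\<^sup>2" by simp
      then have "2 * (- (?a + 1) / (2 * (cmod ?c)\<^sup>2)) * (cmod ?c)\<^sup>2 = - (?a + 1)"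
        by simp
      then show False
        using *[of "- (?a + 1) / (2 * (cmod ?c)\<^sup>2)"] \<open>?b = 0\<close> by simp
    qed
    then show ?thesis
      using True a b by auto
  next
    case False
    then have b': "0 < ?b" using b by auto
    have "2 * (-1 / ?b) * (cmod ?c)\<^sup>2 + (-1 / ?b)\<^sup>2 * (cmod ?c)\<^sup>2 * ?b = - (cmod ?c)\<^sup>2 / ?b"
      using b' by (simp add: power2_eq_square field_simps)
    then have "(cmod ?c)\<^sup>2 / ?b \<le> ?a"
      using *[of "-1 / ?b"] by simp
    then show ?thesis
      using b' by (simp add: field_simps)
  qed
qed

lemma psd_map_id: "psd_map (\<lambda>x. x)"
  by (simp add: psd_map_def cinner_self_nonneg)

lemma cinner_Cauchy_Schwarz: "cmod (cinner x y) \<le> norm x * norm y"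
proof -
  have "(cmod (cinner x y))\<^sup>2 \<le> (norm x * norm y)\<^sup>2"
    using psd_map_Cauchy_Schwarz[OF psd_map_id, of x y] by (simp add: cinner_self power_mult_distrib)
  then show ?thesis
    by (rule power2_le_imp_le) simp
qed

lemma bounded_linear_cinner_left: "bounded_linear (\<lambda>x. cinner x y)"
  by (rule bounded_linear_intro[where K = "norm y"])
     (simp_all add: cinner_add_left scaleR_scaleC cinner_scaleC_left cinner_Cauchy_Schwarz scaleR_conv_of_real)

section \<open>Decomposition into rank one maps\<close>

text \<open>
  One step of a Cholesky factorization. Subtracting the rank one map of the pivot from \<open>R\<close> is
  taking the Schur complement at \<open>v\<close>. When \<open>\<langle>R v, v\<rangle> = 0\<close> the division by zero makes the pivot \<open>0\<close>,
  which is the right value because \<open>R v = 0\<close> then holds for positive semidefinite \<open>R\<close>.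
\<close>

definition pivot :: "('a::complex_inner \<Rightarrow> 'a) \<Rightarrow> 'a \<Rightarrow> 'a" where
  "pivot R v = complex_of_real (1 / sqrt (Re (cinner (R v) v))) *\<^sub>C R v"

definition deflate :: "('a::complex_inner \<Rightarrow> 'a) \<Rightarrow> 'a \<Rightarrow> 'a \<Rightarrow> 'a" where
  "deflate R v x = R x - cinner x (pivot R v) *\<^sub>C pivot R v"

lemma psd_map_eq_0_iff:
  assumes "psd_map R"
  shows "Re (cinner (R v) v) = 0 \<longleftrightarrow> R v = 0"
proof
  assume "Re (cinner (R v) v) = 0"
  then show "R v = 0"
    using psd_map_Cauchy_Schwarz[OF assms, of v "R v"] by (simp add: cinner_self)
qed simp

lemma cmod_cinner_pivot:
  assumes "psd_map R"
  shows "(cmod (cinner x (pivot R v)))\<^sup>2 = (cmod (cinner (R x) v))\<^sup>2 / Re (cinner (R v) v)"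
  using psd_map_real(2)[OF assms, of v]
  by (simp add: pivot_def cinner_scaleC_right norm_mult power_mult_distrib psd_map_symmetric[OF assms]
      power_divide norm_divide)

text \<open>
  The quadratic form drops by \<open>|\<langle>R x, v\<rangle>|\<^sup>2 / \<langle>R v, v\<rangle>\<close> at \<open>x\<close>, and the Cauchy--Schwarz inequality
  says that this is no more than \<open>\<langle>R x, x\<rangle>\<close>.
\<close>

lemma psd_map_deflate:
  assumes "psd_map R"
  shows "psd_map (deflate R v)"
  unfolding psd_map_def
proof (intro conjI allI)
  fix x y z
  show "deflate R v (x + y) = deflate R v x + deflate R v y"
    using assms by (simp add: psd_map_def deflate_def cinner_add_left scaleC_add_left)
  show "deflate R v (z *\<^sub>C x) = z *\<^sub>C deflate R v x"
    using assms by (simp add: psd_map_def deflate_def cinner_scaleC_left scaleC_scaleC scaleC_diff_right)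
  have "cinner (deflate R v x) x = complex_of_real (Re (cinner (R x) x) - (cmod (cinner x (pivot R v)))\<^sup>2)"
    using psd_map_real(1)[OF assms, of x]
    by (simp add: deflate_def cinner_diff_left cinner_scaleC_left cinner_mult_swap)
  moreover have "(cmod (cinner x (pivot R v)))\<^sup>2 \<le> Re (cinner (R x) x)"
  proof -
    have "(cmod (cinner (R x) v))\<^sup>2 / Re (cinner (R v) v) \<le> Re (cinner (R x) x)"
      using psd_map_Cauchy_Schwarz[OF assms, of x v] psd_map_real(2)[OF assms, of v]
        psd_map_real(2)[OF assms, of x]
      by (cases "Re (cinner (R v) v) = 0") (auto simp: divide_le_eq)
    then show ?thesis
      by (simp add: cmod_cinner_pivot[OF assms])
  qed
  ultimately show "cinner (deflate R v x) x \<in> \<real>\<^sub>\<ge>\<^sub>0"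
    by (simp add: complex_nonneg_Reals_iff)
qed

lemma deflate_self:
  assumes "psd_map R"
  shows "deflate R v v = 0"
proof (cases "R v = 0")
  case False
  let ?q = "Re (cinner (R v) v)"
  have q: "0 < ?q"
    using psd_map_real(2)[OF assms, of v] psd_map_eq_0_iff[OF assms, of v] False by auto
  have "cinner v (R v) = complex_of_real ?q"
    using psd_map_symmetric[OF assms] psd_map_real(1)[OF assms] by metis
  then have "cinner v (pivot R v) *\<^sub>C pivot R v
      = complex_of_real (1 / sqrt ?q * ?q * (1 / sqrt ?q)) *\<^sub>C R v"
    by (simp only: pivot_def cinner_scaleC_right scaleC_scaleC complex_cnj_complex_of_real of_real_mult mult_ac)
  also have "1 / sqrt ?q * ?q * (1 / sqrt ?q) = 1"
    using q by (simp add: field_simps)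
  finally show ?thesis
    by (simp add: deflate_def scaleC_one)
qed (simp add: deflate_def pivot_def)

text \<open>
  A pivot lies in the range of \<open>R\<close>, which is orthogonal to the kernel by symmetry. Therefore
  deflating never destroys a kernel vector that an earlier step produced.
\<close>

lemma pivot_orthogonal_kernel:
  assumes "psd_map R" "R u = 0"
  shows "cinner u (pivot R v) = 0"
  using psd_map_symmetric[OF assms(1), of u v] assms(2) by (simp add: pivot_def cinner_scaleC_right)

primrec residual :: "('a::complex_inner \<Rightarrow> 'a) \<Rightarrow> (nat \<Rightarrow> 'a) \<Rightarrow> nat \<Rightarrow> 'a \<Rightarrow> 'a" where
  "residual R c 0 = R"
| "residual R c (Suc n) = deflate (residual R c n) (c n)"

lemma psd_map_residual: "psd_map R \<Longrightarrow> psd_map (residual R c n)"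
  by (induction n) (auto intro: psd_map_deflate)

lemma residual_eq:
  "residual R c n x = R x - (\<Sum>k<n. cinner x (pivot (residual R c k) (c k)) *\<^sub>C pivot (residual R c k) (c k))"
  by (induction n) (auto simp: deflate_def)

lemma residual_vanishes:
  assumes "psd_map R" "i < n"
  shows "residual R c n (c i) = 0"
  using assms(2)
proof (induction n)
  case (Suc n)
  have psd: "psd_map (residual R c n)"
    by (rule psd_map_residual[OF assms(1)])
  show ?case
  proof (cases "i = n")
    case True
    then show ?thesis by (simp add: deflate_self[OF psd])
  next
    case False
    then have "residual R c n (c i) = 0"
      using Suc by simp
    then show ?thesis
      by (simp add: deflate_def pivot_orthogonal_kernel[OF psd])
  qed
qed simp

text \<open>
  Cholesky factorization along an enumeration \<open>c\<close> of \<open>C\<close>. It replaces the square root of \<open>R\<close>: the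
  vectors \<open>g k\<close> play the part of the images of a basis under that root. The sums
  are essentially finite: after step \<open>i\<close> the residual kills \<open>c i\<close> and all later pivots are orthogonal to
  \<open>c i\<close>, so that for \<open>x = c i\<close> only terms with \<open>k \<le> i\<close> are nonzero.
\<close>

lemma psd_map_rank_one_decomposition:
  fixes R :: "'a::complex_inner \<Rightarrow> 'a"
  assumes "psd_map R" "countable C"
  obtains g :: "nat \<Rightarrow> 'a"
  where "\<And>x y. x \<in> C \<Longrightarrow> ((\<lambda>k. cinner y (g k) * cinner (g k) x) has_sum cinner (R y) x) UNIV"
proof (cases "C = {}")
  case False
  define c where "c = from_nat_into C"
  define g where "g k = pivot (residual R c k) (c k)" for k
  have "((\<lambda>k. cinner y (g k) * cinner (g k) x) has_sum cinner (R y) x) UNIV" if x: "x \<in> C" for x y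
  proof -
    obtain i where i: "c i = x"
      using from_nat_into_surj[OF \<open>countable C\<close> x] by (auto simp: c_def)
    have later: "cinner x (g k) = 0" if "i < k" for k
      unfolding g_def i[symmetric]
      by (rule pivot_orthogonal_kernel[OF psd_map_residual[OF assms(1)] residual_vanishes[OF assms(1) that]])
    have "R x = (\<Sum>k<Suc i. cinner x (g k) *\<^sub>C g k)"
      using residual_vanishes[OF assms(1), of i "Suc i" c] residual_eq[of R c "Suc i" x]
      by (simp add: g_def i)
    then have "cinner (R y) x = (\<Sum>k<Suc i. cinner y (cinner x (g k) *\<^sub>C g k))"
      using psd_map_symmetric[OF assms(1), of y x] by (simp only: cinner_sum_right)
    also have "\<dots> = (\<Sum>k<Suc i. cinner y (g k) * cinner (g k) x)"
      using cinner_commute[of "g _" x] by (simp add: cinner_scaleC_right mult.commute)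
    finally have "((\<lambda>k. cinner y (g k) * cinner (g k) x) has_sum cinner (R y) x) {..<Suc i}"
      by (simp add: has_sum_finiteI)
    then show ?thesis
    proof (rule has_sum_cong_neutral[THEN iffD1, rotated -1])
      fix k assume "k \<in> UNIV - {..<Suc i}"
      then have "cinner x (g k) = 0" by (auto intro: later)
      then show "cinner y (g k) * cinner (g k) x = 0"
        using cinner_commute[of "g k" x] by simp
    qed auto
  qed
  then show ?thesis by (rule that)
qed (use that in auto)

section \<open>Bounded operators\<close>

lemma id_blinfun_bounded_operators: "id_blinfun \<in> bounded_operators"
  by (simp add: bounded_operators_def)

lemma scalar_op_apply [simp]: "blinfun_apply (scalar_op z) x = z *\<^sub>C x"
  by transfer simp

lemma bounded_operators_diff_scalar:
  "S \<in> bounded_operators \<Longrightarrow> S - scalar_op z \<in> bounded_operators"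
  by (simp add: bounded_operators_def blinfun.diff_left scaleC_diff_right scaleC_scaleC mult.commute)

lemma bounded_operators_compose:
  "S \<in> bounded_operators \<Longrightarrow> R \<in> bounded_operators \<Longrightarrow> S o\<^sub>L R \<in> bounded_operators"
  by (simp add: bounded_operators_def)

section \<open>Orthonormal bases\<close>

lemma norm_add_orthogonal:
  assumes "cinner x y = 0"
  shows "(norm (x + y))\<^sup>2 = (norm x)\<^sup>2 + (norm y)\<^sup>2"
proof -
  have "cinner (x + y) (x + y) = cinner x x + cinner y y"
    using assms cinner_commute[of y x] by (simp add: cinner_add_left cinner_add_right)
  then show ?thesis
    by (simp only: cinner_self of_real_add[symmetric] of_real_eq_iff)
qed

text \<open>
  Distinct members of \<open>E\<close> are at distance \<open>\<surd>2 > 1\<close>, so a point of a countable dense set that lies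
  within \<open>1/2\<close> of a member determines that member.
\<close>

lemma onb_countable:
  fixes E :: "'a::complex_inner set"
  assumes "separable_space (euclidean :: 'a topology)" "is_onb E"
  shows "countable E"
proof -
  obtain D :: "'a set" where D: "countable D" "closure D = UNIV"
    using assms(1) by (auto simp: separable_space_def)
  have "\<exists>d\<in>D. dist d e < 1 / 2" for e
    using closure_approachable[of e D, THEN iffD1, rule_format, of "1 / 2"] D(2) by simp
  then obtain d where d: "\<And>e. d e \<in> D" "\<And>e. dist (d e) e < 1 / 2"
    by metis
  have "inj_on d E"
  proof (rule inj_onI, rule ccontr)
    fix e f assume ef: "e \<in> E" "f \<in> E" "d e = d f" "e \<noteq> f"
    have "cinner e f = 0" "norm e = 1" "norm f = 1"
      using ef assms(2) by (auto simp: is_onb_def)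
    then have "(norm (e - f))\<^sup>2 = 2"
      using norm_add_orthogonal[of e "- f"] cinner_diff_right[of e 0 f] by simp
    moreover have "norm (e - f) < 1"
      using d(2)[of e] d(2)[of f] dist_triangle_half_r[of "d e" e 1 f] ef(3)
      by (simp add: dist_norm)
    then have "(norm (e - f))\<^sup>2 < 1"
      by (simp add: abs_square_less_1)
    ultimately show False by simp
  qed
  moreover have "countable (d ` E)"
    using D(1) d(1) by (meson countable_subset image_subsetI)
  ultimately show ?thesis
    by (rule countable_image_inj_on[rotated])
qed

lemma cinner_orthonormal_sum:
  assumes "is_onb E" "finite F" "F \<subseteq> E" "f \<in> F"
  shows "cinner (\<Sum>e\<in>F. u e *\<^sub>C e) f = u f"
proof -
  have "cinner (u e *\<^sub>C e) f = (if e = f then u f else 0)" if "e \<in> F" for e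
  proof -
    have "e \<in> E" "f \<in> E"
      using assms(3,4) that by auto
    then show ?thesis
      using assms(1) by (auto simp: is_onb_def cinner_scaleC_left cinner_self)
  qed
  then show ?thesis
    using assms by (simp add: cinner_sum_left)
qed

text \<open>
  A vector \<open>y\<close> of the span that is close to \<open>x\<close> uses a finite part \<open>F\<close> of \<open>E\<close>. For every finite
  \<open>G \<supseteq> F\<close> the partial sum over \<open>G\<close> is the orthogonal projection of \<open>x\<close>, hence at least as close to
  \<open>x\<close> as \<open>y\<close> is.
\<close>

lemma onb_expansion:
  assumes "is_onb E"
  shows "((\<lambda>e. cinner x e *\<^sub>C e) has_sum x) E"
proof -
  interpret vs: vector_space "scaleC :: complex \<Rightarrow> 'a \<Rightarrow> 'a"
    by (rule vector_space_scaleC)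
  have "\<exists>F. finite F \<and> F \<subseteq> E \<and>
      (\<forall>G. finite G \<and> F \<subseteq> G \<and> G \<subseteq> E \<longrightarrow> dist (\<Sum>e\<in>G. cinner x e *\<^sub>C e) x < \<epsilon>)" if "\<epsilon> > 0" for \<epsilon>
  proof -
    have "closure (vs.span E) = UNIV"
      using assms by (simp add: is_onb_def)
    then obtain y where y: "y \<in> vs.span E" "dist y x < \<epsilon>"
      using closure_approachable[of x "vs.span E"] \<open>\<epsilon> > 0\<close> by auto
    then obtain F u where F: "finite F" "F \<subseteq> E" and yF: "y = (\<Sum>e\<in>F. u e *\<^sub>C e)"
      unfolding vs.span_explicit by auto
    have "dist (\<Sum>e\<in>G. cinner x e *\<^sub>C e) x < \<epsilon>" if G: "finite G" "F \<subseteq> G" "G \<subseteq> E" for G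
    proof -
      define p where "p = (\<Sum>e\<in>G. cinner x e *\<^sub>C e)"
      have orth: "cinner (x - p) e = 0" if "e \<in> G" for e
        using cinner_orthonormal_sum[OF assms G(1,3) that, of "cinner x"]
        by (simp add: p_def cinner_diff_left)
      have "cinner (x - p) p = 0"
        by (subst (2) p_def) (simp add: cinner_sum_right cinner_scaleC_right orth)
      moreover have "cinner (x - p) y = 0"
        using G(2) by (simp add: yF cinner_sum_right cinner_scaleC_right orth subset_iff)
      ultimately have "cinner (x - p) (p - y) = 0"
        by (simp add: cinner_diff_right)
      from norm_add_orthogonal[OF this] have "(norm (x - p))\<^sup>2 \<le> (norm (x - y))\<^sup>2"
        by simp
      then have "norm (x - p) \<le> norm (x - y)"
        by (rule power2_le_imp_le) simp
      then show ?thesis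
        using y(2) by (simp add: p_def dist_norm norm_minus_commute)
    qed
    then show ?thesis
      using F by blast
  qed
  then show ?thesis
    by (auto simp: has_sum_def tendsto_iff eventually_finite_subsets_at_top)
qed

text \<open>
  The expansion of \<open>x\<close>, pushed through the continuous functional \<open>v \<mapsto> \<langle>X v, y\<rangle>\<close>.
\<close>

lemma has_sum_cinner_onb:
  assumes "is_onb E" "X \<in> bounded_operators"
  shows "((\<lambda>e. cinner (X e) y * cinner x e) has_sum cinner (X x) y) E"
proof -
  have "bounded_linear (\<lambda>v. cinner (blinfun_apply X v) y)"
    by (rule bounded_linear_compose[OF bounded_linear_cinner_left blinfun.bounded_linear_right])
  from has_sum_bounded_linear[OF this onb_expansion[OF assms(1), of x]]
  show ?thesis
    using assms(2) by (simp add: bounded_operators_def cinner_scaleC_left mult.commute)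
qed

lemma Parseval:
  assumes "is_onb E"
  shows "((\<lambda>e. (cmod (cinner x e))\<^sup>2) has_sum (norm x)\<^sup>2) E"
proof -
  have "cinner e x * cinner x e = complex_of_real ((cmod (cinner x e))\<^sup>2)" for e
    by (metis cinner_mult_swap mult.commute)
  then have "((\<lambda>e. complex_of_real ((cmod (cinner x e))\<^sup>2)) has_sum complex_of_real ((norm x)\<^sup>2)) E"
    using has_sum_cinner_onb[OF assms id_blinfun_bounded_operators, of x x]
    by (simp add: cinner_self)
  then show ?thesis
    by (simp only: has_sum_of_real_iff)
qed

text \<open>
  This is the Bessel inequality for the adjoint of \<open>X\<close> applied to \<open>y\<close>. For
  \<open>v = (\<Sum>e\<in>F. cnj \<langle>X e, y\<rangle> e)\<close> the sum equals both \<open>\<parallel>v\<parallel>\<^sup>2\<close> and \<open>\<langle>X v, y\<rangle>\<close>, so that \<open>\<parallel>v\<parallel>\<^sup>2 \<le> \<parallel>X\<parallel> \<parallel>v\<parallel> \<parallel>y\<parallel>\<close>.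
\<close>

lemma sum_cinner_image_onb_le:
  assumes "is_onb E" "X \<in> bounded_operators" "finite F" "F \<subseteq> E"
  shows "(\<Sum>e\<in>F. (cmod (cinner (X e) y))\<^sup>2) \<le> (norm X * norm y)\<^sup>2"
proof -
  let ?S = "\<Sum>e\<in>F. (cmod (cinner (X e) y))\<^sup>2"
  define v where "v = (\<Sum>e\<in>F. cnj (cinner (X e) y) *\<^sub>C e)"
  have sq: "complex_of_real ?S = (\<Sum>e\<in>F. cinner (X e) y * cnj (cinner (X e) y))"
    by (simp only: of_real_sum complex_norm_square)
  have "cinner v v = (\<Sum>e\<in>F. cinner (X e) y * cinner v e)"
    by (subst (2) v_def) (simp add: cinner_sum_right cinner_scaleC_right)
  also have "\<dots> = (\<Sum>e\<in>F. cinner (X e) y * cnj (cinner (X e) y))"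
    unfolding v_def by (intro sum.cong refl) (simp add: cinner_orthonormal_sum[OF assms(1,3,4)])
  finally have v: "(norm v)\<^sup>2 = ?S"
    by (simp only: sq[symmetric] cinner_self of_real_eq_iff)
  have "cinner (X v) y = complex_of_real ?S"
    using assms(2) by (simp add: v_def blinfun.sum_right cinner_sum_left bounded_operators_def
        cinner_scaleC_left sq mult.commute del: of_real_sum)
  then have "?S = cmod (cinner (X v) y)"
    by (simp add: sum_nonneg del: of_real_sum)
  also have "\<dots> \<le> norm (X v) * norm y"
    by (rule cinner_Cauchy_Schwarz)
  also have "\<dots> \<le> (norm X * norm v) * norm y"
    by (intro mult_right_mono norm_blinfun) simp
  finally have "norm v * norm v \<le> norm v * (norm X * norm y)"
    using v by (simp add: power2_eq_square mult_ac)
  then have "norm v \<le> norm X * norm y"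
    by (cases "norm v = 0") auto
  then show ?thesis
    using v by (metis norm_ge_zero power_mono)
qed

section \<open>States as mixtures of vectors\<close>

text \<open>
  Formally, \<open>Q = (\<Sum>k. \<langle>\<cdot>, g k\<rangle> g k)\<close> and the trace of the composition of \<open>Q\<close> with \<open>X\<close> is evaluated by
  summing \<open>\<langle>X e, g k\<rangle> \<langle>g k, e\<rangle>\<close> over \<open>k\<close> first or over \<open>e\<close> first. The exchange is legitimate because
  the absolute value of a term is at most \<open>|\<langle>X e, g k\<rangle>|\<^sup>2 + |\<langle>g k, e\<rangle>|\<^sup>2\<close>, and both parts are summable
  over all pairs: the second adds up to the trace of \<open>Q\<close>, the first to at most \<open>\<parallel>X\<parallel>\<^sup>2\<close> times that.
\<close>

lemma trace_vector_decomposition: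
  fixes E :: "'a::complex_inner set"
  assumes "is_onb E" "countable E" "psd_map Q" "(\<lambda>e. cinner (Q e) e) summable_on E"
  obtains g :: "nat \<Rightarrow> 'a" where "\<And>X. X \<in> bounded_operators \<Longrightarrow>
       ((\<lambda>k. cinner (X (g k)) (g k)) has_sum (\<Sum>\<^sub>\<infinity>e\<in>E. cinner (Q (X e)) e)) UNIV"
proof -
  obtain g :: "nat \<Rightarrow> 'a" where g: "\<And>x y. x \<in> E \<Longrightarrow>
      ((\<lambda>k. cinner y (g k) * cinner (g k) x) has_sum cinner (Q y) x) UNIV"
    using psd_map_rank_one_decomposition[OF assms(3,2)] by metis
  define b where "b = (\<lambda>(k, e). (cmod (cinner (g k) e))\<^sup>2)"
  have b_e: "((\<lambda>k. b (k, e)) has_sum Re (cinner (Q e) e)) UNIV" if "e \<in> E" for e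
    using has_sum_Re[OF g[OF that, of e]]
    by (simp only: cinner_mult_swap cmod_cinner_commute[of e] Re_complex_of_real b_def prod.case)
  have "(\<lambda>e. Re (cinner (Q e) e)) summable_on E"
    using assms(4) has_sum_Re unfolding summable_on_def by blast
  then have "(\<lambda>(e, k). b (k, e)) summable_on (E \<times> UNIV)"
    by (rule summable_on_SigmaI[rotated]) (use b_e in \<open>auto simp: b_def\<close>)
  then have b: "b summable_on (UNIV \<times> E)"
    by (subst summable_on_swap) (simp add: case_prod_unfold)
  have b_k: "((\<lambda>e. b (k, e)) has_sum (norm (g k))\<^sup>2) E" for k
    using Parseval[OF assms(1), of "g k"] by (simp add: b_def)
  have gs: "(\<lambda>k. (norm (g k))\<^sup>2) summable_on UNIV"
    using has_sum_SigmaD[OF has_sum_infsum[OF b] b_k] by (auto simp: summable_on_def)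
  have "((\<lambda>k. cinner (X (g k)) (g k)) has_sum (\<Sum>\<^sub>\<infinity>e\<in>E. cinner (Q (X e)) e)) UNIV"
    if X: "X \<in> bounded_operators" for X
  proof -
    define a where "a = (\<lambda>(k, e). (cmod (cinner (X e) (g k)))\<^sup>2)"
    have a_k: "(\<lambda>e. a (k, e)) summable_on E" for k
      by (rule nonneg_bdd_above_summable_on)
         (auto simp: a_def intro!: bdd_aboveI[where M = "(norm X * norm (g k))\<^sup>2"]
            sum_cinner_image_onb_le[OF assms(1) X])
    have "(\<lambda>k. (norm X)\<^sup>2 * (norm (g k))\<^sup>2) summable_on UNIV"
      by (rule summable_on_cmult_right[OF gs])
    then have "(\<lambda>k. norm (\<Sum>\<^sub>\<infinity>e\<in>E. a (k, e))) summable_on UNIV"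
    proof (rule Infinite_Sum.abs_summable_on_comparison_test')
      fix k
      have "(\<Sum>\<^sub>\<infinity>e\<in>E. a (k, e)) \<le> (norm X * norm (g k))\<^sup>2"
        using a_k sum_cinner_image_onb_le[OF assms(1) X]
        by (intro infsum_le_finite_sums) (auto simp: a_def)
      moreover have "0 \<le> (\<Sum>\<^sub>\<infinity>e\<in>E. a (k, e))"
        by (rule infsum_nonneg) (simp add: a_def)
      ultimately show "norm (\<Sum>\<^sub>\<infinity>e\<in>E. a (k, e)) \<le> (norm X)\<^sup>2 * (norm (g k))\<^sup>2"
        by (simp add: power_mult_distrib)
    qed
    then have "(\<lambda>k. \<Sum>\<^sub>\<infinity>e\<in>E. a (k, e)) summable_on UNIV"
      by (rule abs_summable_summable)
    then have a: "a summable_on (UNIV \<times> E)"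
      by (rule summable_on_SigmaI[rotated]) (use a_k in \<open>auto simp: a_def\<close>)
    define f where "f = (\<lambda>(k, e). cinner (X e) (g k) * cinner (g k) e)"
    have "(\<lambda>p. norm (f p)) summable_on (UNIV \<times> E)"
    proof (rule Infinite_Sum.abs_summable_on_comparison_test'[OF summable_on_add[OF a b]])
      fix p :: "nat \<times> 'a"
      have "s * t \<le> s\<^sup>2 + t\<^sup>2" if "0 \<le> s" "0 \<le> t" for s t :: real
        using sum_squares_bound[of s t] that mult_nonneg_nonneg[OF that] by linarith
      then show "norm (f p) \<le> a p + b p"
        by (simp add: f_def a_def b_def case_prod_unfold norm_mult)
    qed
    then have "f summable_on (UNIV \<times> E)"
      by (rule abs_summable_summable)
    then have f: "(f has_sum infsum f (UNIV \<times> E)) (UNIV \<times> E)"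
      by (rule has_sum_infsum)
    have "((\<lambda>k. cinner (X (g k)) (g k)) has_sum infsum f (UNIV \<times> E)) UNIV"
      by (rule has_sum_SigmaD[OF f])
         (use has_sum_cinner_onb[OF assms(1) X] in \<open>simp add: f_def\<close>)
    moreover have "((\<lambda>e. cinner (Q (X e)) e) has_sum infsum f (UNIV \<times> E)) E"
      by (rule has_sum_SigmaD[OF f[unfolded has_sum_swap[of f UNIV]]])
         (use g in \<open>simp add: f_def\<close>)
    ultimately show ?thesis
      by (simp add: infsumI)
  qed
  then show ?thesis
    by (rule that)
qed

lemma psd_map_positive_op: "positive_op Q \<Longrightarrow> psd_map (blinfun_apply Q)"
  by (simp add: psd_map_def positive_op_def bounded_operators_def blinfun.add_right)

text \<open>
  The trace of \<open>Q\<close> is the value of one fixed infinite sum, which would be \<open>0\<close> if it did not converge.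
  Hence trace \<open>1\<close> yields summability along the basis that defines the trace, and \<open>X = id\<close> turns it
  into the normalization of \<open>g\<close>.
\<close>

lemma state_vector_decomposition:
  fixes Q :: "'a::chilbert_space \<Rightarrow>\<^sub>L 'a"
  assumes "separable_space (euclidean :: 'a topology)" "Q \<in> states"
  obtains g :: "nat \<Rightarrow> 'a" where "((\<lambda>k. (norm (g k))\<^sup>2) has_sum 1) UNIV"
    "\<And>X. X \<in> bounded_operators \<Longrightarrow> ((\<lambda>k. cinner (X (g k)) (g k)) has_sum tr (Q o\<^sub>L X)) UNIV"
proof -
  define E :: "'a set" where "E = (SOME E. is_onb E)"
  have Q: "positive_op Q" "trace_class Q" "tr Q = 1"
    using assms(2) by (auto simp: states_def)
  have E: "is_onb E"
    using Q(2) unfolding E_def trace_class_def by (auto intro: someI)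
  have "(\<lambda>e. cinner (Q e) e) summable_on E"
    using Q(3) infsum_not_exists[of "\<lambda>e. cinner (Q e) e" E] by (auto simp: tr_def E_def)
  then obtain g :: "nat \<Rightarrow> 'a" where g: "\<And>X. X \<in> bounded_operators \<Longrightarrow>
       ((\<lambda>k. cinner (X (g k)) (g k)) has_sum (\<Sum>\<^sub>\<infinity>e\<in>E. cinner (Q (X e)) e)) UNIV"
    using trace_vector_decomposition[OF E onb_countable[OF assms(1) E] psd_map_positive_op[OF Q(1)]]
    by metis
  have tr: "((\<lambda>k. cinner (X (g k)) (g k)) has_sum tr (Q o\<^sub>L X)) UNIV" if "X \<in> bounded_operators" for X
    using g[OF that] by (simp add: tr_def E_def)
  have "Q o\<^sub>L id_blinfun = Q"
    by (rule blinfun_eqI) simp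
  then have norms: "((\<lambda>k. complex_of_real ((norm (g k))\<^sup>2)) has_sum complex_of_real 1) UNIV"
    using tr[OF id_blinfun_bounded_operators] Q(3) by (simp add: cinner_self)
  then show ?thesis
    using that[OF norms[unfolded has_sum_of_real_iff] tr] by blast
qed

section \<open>The covariance inequality\<close>

lemma norm_diff_scaleC_square:
  "(norm (x - \<tau> *\<^sub>C y))\<^sup>2
     = (norm x)\<^sup>2 - 2 * Re (cnj \<tau> * cinner x y) + (cmod \<tau>)\<^sup>2 * (norm y)\<^sup>2"
proof -
  have "cinner (x - \<tau> *\<^sub>C y) (x - \<tau> *\<^sub>C y) =
      cinner x x - cnj \<tau> * cinner x y - cnj (cnj \<tau> * cinner x y) + (\<tau> * cnj \<tau>) * cinner y y"
    using cinner_commute[of y x]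
    by (simp add: cinner_diff_left cinner_diff_right cinner_scaleC_left cinner_scaleC_right algebra_simps)
  also have "\<tau> * cnj \<tau> = complex_of_real ((cmod \<tau>)\<^sup>2)"
    using complex_norm_square[of \<tau>] by simp
  finally have "Re (cinner (x - \<tau> *\<^sub>C y) (x - \<tau> *\<^sub>C y)) =
      Re (cinner x x - cnj \<tau> * cinner x y - cnj (cnj \<tau> * cinner x y)
        + complex_of_real ((cmod \<tau>)\<^sup>2) * cinner y y)"
    by (rule arg_cong)
  then have "(norm (x - \<tau> *\<^sub>C y))\<^sup>2 = (norm x)\<^sup>2 - Re (cnj \<tau> * cinner x y)
      - Re (cnj \<tau> * cinner x y) + (cmod \<tau>)\<^sup>2 * (norm y)\<^sup>2"
    by (simp only: cinner_self minus_complex.sel plus_complex.sel Re_complex_of_real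
        of_real_mult[symmetric] cnj.sel)
  then show ?thesis
    by simp
qed

lemma has_sum_diff:
  fixes f g :: "'b \<Rightarrow> 'c::real_normed_vector"
  assumes "(f has_sum a) A" "(g has_sum b) A"
  shows "((\<lambda>x. f x - g x) has_sum (a - b)) A"
  using has_sum_add[OF assms(1), of "\<lambda>x. - g x" "- b"] assms(2) by (simp add: has_sum_uminus)

text \<open>
  Put \<open>h k = T (g k) - \<tau> g k\<close>. Since \<open>\<tau>\<close> is the mean of \<open>T\<close>, the sum of \<open>\<langle>h k, g k\<rangle>\<close> vanishes, and so
  \<open>\<gamma> - \<alpha> \<tau>\<close> is the sum of \<open>\<langle>(A - a) (h k), g k\<rangle>\<close> for every \<open>a\<close>. The Cauchy--Schwarz inequality bounds it by
  \<open>\<parallel>A - a\<parallel>\<close> times the root of the variance \<open>(\<Sum>k. \<parallel>h k\<parallel>\<^sup>2)\<close>. The variance does not change when \<open>T\<close> is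
  translated by \<open>t\<close>; it equals \<open>(\<Sum>k. \<parallel>(T - t) (g k)\<parallel>\<^sup>2) - |\<tau> - t|\<^sup>2\<close>, which is at most \<open>\<parallel>T - t\<parallel>\<^sup>2\<close>.
\<close>

lemma covariance_vectors_le:
  fixes g :: "nat \<Rightarrow> 'a::complex_inner"
  assumes "((\<lambda>k. (norm (g k))\<^sup>2) has_sum 1) UNIV"
    and A: "A \<in> bounded_operators" and T: "T \<in> bounded_operators"
    and "((\<lambda>k. cinner (A (T (g k))) (g k)) has_sum \<gamma>) UNIV"
    and "((\<lambda>k. cinner (A (g k)) (g k)) has_sum \<alpha>) UNIV"
    and "((\<lambda>k. cinner (T (g k)) (g k)) has_sum \<tau>) UNIV"
  shows "cmod (\<gamma> - \<alpha> * \<tau>) \<le> norm (A - scalar_op a) * norm (T - scalar_op t)"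
proof -
  define A' T' where "A' = A - scalar_op a" and "T' = T - scalar_op t"
  define h where "h k = T (g k) - \<tau> *\<^sub>C g k" for k
  have one: "((\<lambda>k. cinner (g k) (g k)) has_sum 1) UNIV"
    using has_sum_of_real[OF assms(1), where 'a = complex] by (simp add: cinner_self)
  have cov: "((\<lambda>k. cinner (A' (h k)) (g k)) has_sum (\<gamma> - \<alpha> * \<tau>)) UNIV"
  proof -
    have "((\<lambda>k. cinner (A (T (g k))) (g k) - \<tau> * cinner (A (g k)) (g k)
        - a * (cinner (T (g k)) (g k) - \<tau> * cinner (g k) (g k))) has_sum
        (\<gamma> - \<tau> * \<alpha> - a * (\<tau> - \<tau> * 1))) UNIV"
      by (intro has_sum_diff has_sum_cmult_right assms one)
    moreover have "cinner (A' (h k)) (g k) = cinner (A (T (g k))) (g k) - \<tau> * cinner (A (g k)) (g k)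
        - a * (cinner (T (g k)) (g k) - \<tau> * cinner (g k) (g k))" for k
      using A by (simp add: A'_def h_def blinfun.diff_left blinfun.diff_right bounded_operators_def
          scaleC_diff_right cinner_add_left cinner_diff_left cinner_scaleC_left algebra_simps)
    ultimately show ?thesis
      by (simp add: mult.commute)
  qed
  have h_norm: "(norm (h k))\<^sup>2 = (norm (T' (g k)))\<^sup>2 - 2 * Re (cnj (\<tau> - t) * cinner (T' (g k)) (g k))
      + (cmod (\<tau> - t))\<^sup>2 * (norm (g k))\<^sup>2" for k
  proof -
    have "h k = T' (g k) - (\<tau> - t) *\<^sub>C g k"
      by (simp add: h_def T'_def blinfun.diff_left scaleC_diff_left)
    then show ?thesis by (simp only: norm_diff_scaleC_square)
  qed
  have "((\<lambda>k. cinner (T (g k)) (g k) - t * cinner (g k) (g k)) has_sum (\<tau> - t * 1)) UNIV"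
    by (intro has_sum_diff has_sum_cmult_right assms one)
  then have T'_sum: "((\<lambda>k. cinner (T' (g k)) (g k)) has_sum (\<tau> - t)) UNIV"
    by (simp add: T'_def blinfun.diff_left cinner_diff_left cinner_scaleC_left)
  have variance: "(\<Sum>k\<in>F. (norm (h k))\<^sup>2) \<le> (norm T')\<^sup>2" if "finite F" for F
  proof -
    let ?f = "\<lambda>k. (norm T')\<^sup>2 * (norm (g k))\<^sup>2 - 2 * Re (cnj (\<tau> - t) * cinner (T' (g k)) (g k))
      + (cmod (\<tau> - t))\<^sup>2 * (norm (g k))\<^sup>2"
    have f: "(?f has_sum ((norm T')\<^sup>2 * 1 - 2 * Re (cnj (\<tau> - t) * (\<tau> - t)) + (cmod (\<tau> - t))\<^sup>2 * 1)) UNIV"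
      by (intro has_sum_diff has_sum_add has_sum_cmult_right has_sum_Re assms(1) T'_sum)
    have Re: "Re (cnj (\<tau> - t) * (\<tau> - t)) = (cmod (\<tau> - t))\<^sup>2"
      using complex_norm_square[of "\<tau> - t"] by (metis Re_complex_of_real mult.commute)
    have le: "(norm (h k))\<^sup>2 \<le> ?f k" for k
    proof -
      have "(norm (T' (g k)))\<^sup>2 \<le> (norm T' * norm (g k))\<^sup>2"
        by (intro power_mono norm_blinfun) simp
      then show ?thesis
        unfolding h_norm by (simp add: power_mult_distrib)
    qed
    have "(\<Sum>k\<in>F. (norm (h k))\<^sup>2) \<le> sum ?f F"
      by (rule sum_mono) (rule le)
    also have "sum ?f F \<le> (norm T')\<^sup>2 * 1 - 2 * Re (cnj (\<tau> - t) * (\<tau> - t)) + (cmod (\<tau> - t))\<^sup>2 * 1"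
    proof (rule has_sum_mono_neutral[OF has_sum_finite[OF that] f])
      show "0 \<le> ?f k" for k
        using le[of k] by (meson order_trans zero_le_power2)
    qed auto
    also have "\<dots> \<le> (norm T')\<^sup>2"
      unfolding Re by simp
    finally show ?thesis .
  qed
  have partial: "(\<Sum>k\<in>F. norm (cinner (A' (h k)) (g k))) \<le> norm A' * norm T'" if F: "finite F" for F
  proof -
    have "norm (cinner (A' (h k)) (g k)) \<le> norm A' * (\<bar>norm (h k)\<bar> * \<bar>norm (g k)\<bar>)" for k
    proof -
      have "norm (cinner (A' (h k)) (g k)) \<le> norm (A' (h k)) * norm (g k)"
        by (rule cinner_Cauchy_Schwarz)
      also have "\<dots> \<le> norm A' * norm (h k) * norm (g k)"
        by (intro mult_right_mono norm_blinfun) simp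
      finally show ?thesis by (simp add: mult.assoc)
    qed
    then have "(\<Sum>k\<in>F. norm (cinner (A' (h k)) (g k))) \<le> norm A' * (\<Sum>k\<in>F. \<bar>norm (h k)\<bar> * \<bar>norm (g k)\<bar>)"
      unfolding sum_distrib_left by (rule sum_mono)
    also have "(\<Sum>k\<in>F. \<bar>norm (h k)\<bar> * \<bar>norm (g k)\<bar>) \<le> L2_set (\<lambda>k. norm (h k)) F * L2_set (\<lambda>k. norm (g k)) F"
      by (rule L2_set_mult_ineq)
    also have "\<dots> \<le> norm T' * 1"
    proof (intro mult_mono)
      show "L2_set (\<lambda>k. norm (h k)) F \<le> norm T'"
        unfolding L2_set_def by (rule real_le_lsqrt) (auto simp: sum_nonneg variance[OF F])
      have "(\<Sum>k\<in>F. (norm (g k))\<^sup>2) \<le> 1"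
        by (rule has_sum_mono_neutral[OF has_sum_finite[OF F] assms(1)]) auto
      then show "L2_set (\<lambda>k. norm (g k)) F \<le> 1"
        by (simp add: L2_set_def)
    qed (auto simp: L2_set_nonneg)
    finally show ?thesis
      by (simp add: mult_left_mono)
  qed
  have "(\<lambda>k. norm (cinner (A' (h k)) (g k))) summable_on UNIV"
    by (rule nonneg_bdd_above_summable_on) (auto intro!: bdd_aboveI partial)
  then have s: "((\<lambda>k. norm (cinner (A' (h k)) (g k))) has_sum (\<Sum>\<^sub>\<infinity>k. norm (cinner (A' (h k)) (g k)))) UNIV"
    by (rule has_sum_infsum)
  have "cmod (\<gamma> - \<alpha> * \<tau>) \<le> (\<Sum>\<^sub>\<infinity>k. norm (cinner (A' (h k)) (g k)))"
    by (rule norm_has_sum_bound[OF s cov])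
  also have "\<dots> \<le> norm A' * norm T'"
    by (rule has_sum_le_finite_sums[OF s]) (rule partial)
  finally show ?thesis
    by (simp add: A'_def T'_def)
qed

lemma covariance_state_le:
  fixes A T Q :: "'a::chilbert_space \<Rightarrow>\<^sub>L 'a"
  assumes "separable_space (euclidean :: 'a topology)" "Q \<in> states"
    and "A \<in> bounded_operators" "T \<in> bounded_operators"
  shows "cmod (tr (Q o\<^sub>L A o\<^sub>L T) - tr (Q o\<^sub>L A) * tr (Q o\<^sub>L T)) \<le> norm (A - scalar_op a) * norm (T - scalar_op t)"
proof -
  obtain g :: "nat \<Rightarrow> 'a" where g: "((\<lambda>k. (norm (g k))\<^sup>2) has_sum 1) UNIV"
    "\<And>X. X \<in> bounded_operators \<Longrightarrow> ((\<lambda>k. cinner (X (g k)) (g k)) has_sum tr (Q o\<^sub>L X)) UNIV"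
    using state_vector_decomposition[OF assms(1,2)] by metis
  have assoc: "Q o\<^sub>L A o\<^sub>L T = Q o\<^sub>L (A o\<^sub>L T)"
    by (rule blinfun_eqI) simp
  have "((\<lambda>k. cinner (A (T (g k))) (g k)) has_sum tr (Q o\<^sub>L A o\<^sub>L T)) UNIV"
    using g(2)[OF bounded_operators_compose[OF assms(3,4)]] by (simp add: assoc)
  then show ?thesis
    by (rule covariance_vectors_le[OF g(1) assms(3,4) _ g(2)[OF assms(3)] g(2)[OF assms(4)]])
qed

section \<open>The distance to the scalars\<close>

lemma norm_scalar_op_le: "norm (scalar_op z :: 'a::complex_inner \<Rightarrow>\<^sub>L 'a) \<le> cmod z"
  by (rule norm_blinfun_bound) (simp_all add: norm_scaleC)

lemma norm_scalar_op:
  assumes "(x :: 'a::complex_inner) \<noteq> 0"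
  shows "norm (scalar_op z :: 'a \<Rightarrow>\<^sub>L 'a) = cmod z"
proof (rule antisym[OF norm_scalar_op_le])
  have "cmod z * norm x \<le> norm (scalar_op z :: 'a \<Rightarrow>\<^sub>L 'a) * norm x"
    using norm_blinfun[of "scalar_op z :: 'a \<Rightarrow>\<^sub>L 'a" x] by (simp add: norm_scaleC)
  then show "cmod z \<le> norm (scalar_op z :: 'a \<Rightarrow>\<^sub>L 'a)"
    using assms by simp
qed

lemma scalar_op_add: "scalar_op (z + u) = scalar_op z + scalar_op u"
  by (rule blinfun_eqI) (simp add: blinfun.add_left scaleC_add_left)

lemma scalar_op_diff: "scalar_op (z - u) = scalar_op z - scalar_op u"
  by (rule blinfun_eqI) (simp add: blinfun.diff_left scaleC_diff_left)

lemma scalar_op_0 [simp]: "scalar_op 0 = 0"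
  by (rule blinfun_eqI) simp

lemma norm_diff_scalar_ge:
  fixes S :: "'a::complex_inner \<Rightarrow>\<^sub>L 'a"
  assumes "(x :: 'a) \<noteq> 0"
  shows "cmod z - norm S \<le> norm (S - scalar_op z)"
  using norm_triangle_ineq3[of S "scalar_op z"] norm_scalar_op[OF assms, of z] by linarith

lemma continuous_on_norm_diff_scalar: "continuous_on U (\<lambda>z. norm (S - scalar_op z))"
proof -
  have "continuous_on U (scalar_op :: complex \<Rightarrow> 'a \<Rightarrow>\<^sub>L 'a)"
    unfolding continuous_on_iff dist_norm
    using norm_scalar_op_le[where 'a = 'a] by (metis scalar_op_diff order_le_less_trans)
  then show ?thesis
    by (intro continuous_intros)
qed

text \<open>
  Outside the disc of radius \<open>2 \<parallel>S\<parallel>\<close> the norm of \<open>S - z\<close> exceeds its value at \<open>z = 0\<close>, and on the disc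
  it attains its minimum by compactness.
\<close>

lemma dist_scalars_attained:
  fixes S :: "'a::complex_inner \<Rightarrow>\<^sub>L 'a"
  assumes "(x :: 'a) \<noteq> 0"
  obtains c where "dist_scalars S = norm (S - scalar_op c)"
    "\<And>z. norm (S - scalar_op c) \<le> norm (S - scalar_op z)"
proof -
  let ?f = "\<lambda>z. norm (S - scalar_op z)"
  have "\<exists>c\<in>cball 0 (2 * norm S). \<forall>z\<in>cball 0 (2 * norm S). ?f c \<le> ?f z"
    by (rule continuous_attains_inf) (auto intro: continuous_on_norm_diff_scalar)
  then obtain c where "\<forall>z\<in>cball 0 (2 * norm S). ?f c \<le> ?f z"
    by blast
  then have c: "?f c \<le> ?f z" if "cmod z \<le> 2 * norm S" for z
    using that by simp
  have min: "?f c \<le> ?f z" for z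
  proof (cases "cmod z \<le> 2 * norm S")
    case False
    then have "?f 0 \<le> ?f z"
      using norm_diff_scalar_ge[OF assms, of z S] by simp
    then show ?thesis
      using c[of 0] by simp
  qed (rule c)
  have "dist_scalars S = ?f c"
    unfolding dist_scalars_def by (rule cInf_eq_minimum) (auto intro: min)
  then show ?thesis
    using min that by blast
qed

section \<open>The spectrum of a transloid operator\<close>

lemma spectrum_diff_scalar: "spectrum (S - scalar_op \<mu>) = (\<lambda>z. z - \<mu>) ` spectrum S"
proof -
  have "z \<in> spectrum (S - scalar_op \<mu>) \<longleftrightarrow> z + \<mu> \<in> spectrum S" for z
    by (simp add: spectrum_def scalar_op_add algebra_simps)
  then show ?thesis
    by (force simp: image_iff)
qed

text \<open>
  If \<open>\<parallel>S\<parallel> < |z|\<close>, then \<open>x \<mapsto> (S x - y) / z\<close> is a contraction, whose fixed point solves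
  \<open>(S - z) x = y\<close>. The lower bound \<open>\<parallel>(S - z) x\<parallel> \<ge> (|z| - \<parallel>S\<parallel>) \<parallel>x\<parallel>\<close> makes the solution unique and its
  dependence on \<open>y\<close> bounded.
\<close>

lemma cmod_le_norm_if_in_spectrum:
  fixes S :: "'a::chilbert_space \<Rightarrow>\<^sub>L 'a"
  assumes "S \<in> bounded_operators" "z \<in> spectrum S"
  shows "cmod z \<le> norm S"
proof (rule ccontr)
  assume "\<not> cmod z \<le> norm S"
  then have z: "norm S < cmod z" "z \<noteq> 0"
    using norm_ge_zero[of S] by auto
  let ?N = "S - scalar_op z"
  have N: "?N \<in> bounded_operators"
    by (rule bounded_operators_diff_scalar[OF assms(1)])
  have below: "(cmod z - norm S) * norm x \<le> norm (?N x)" for x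
  proof -
    have "norm (S x) \<le> norm S * norm x"
      by (rule norm_blinfun)
    then show ?thesis
      using norm_triangle_ineq3[of "S x" "z *\<^sub>C x"]
      by (simp add: blinfun.diff_left norm_scaleC left_diff_distrib)
  qed
  have "\<exists>!x. (1 / z) *\<^sub>C (S x - y) = x" for y
  proof (rule banach_fix_type)
    show "\<forall>x x'. dist ((1 / z) *\<^sub>C (S x - y)) ((1 / z) *\<^sub>C (S x' - y)) \<le> (norm S / cmod z) * dist x x'"
    proof (intro allI)
      fix x x'
      have "(1 / z) *\<^sub>C (S x - y) - (1 / z) *\<^sub>C (S x' - y) = (1 / z) *\<^sub>C S (x - x')"
        by (simp add: scaleC_diff_right[symmetric] blinfun.diff_right)
      then show "dist ((1 / z) *\<^sub>C (S x - y)) ((1 / z) *\<^sub>C (S x' - y)) \<le> (norm S / cmod z) * dist x x'"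
        using norm_blinfun[of S "x - x'"] z
        by (simp add: dist_norm norm_scaleC norm_divide divide_right_mono)
    qed
  qed (use z in \<open>auto simp: divide_less_eq\<close>)
  then have "\<exists>x. ?N x = y" for y
  proof -
    obtain x where "(1 / z) *\<^sub>C (S x - y) = x"
      using \<open>\<And>y. \<exists>!x. (1 / z) *\<^sub>C (S x - y) = x\<close> by blast
    then have "z *\<^sub>C x = z *\<^sub>C (1 / z) *\<^sub>C (S x - y)"
      by simp
    then have "z *\<^sub>C x = S x - y"
      using z by (simp add: scaleC_scaleC scaleC_one)
    then show ?thesis
      by (intro exI[of _ x]) (simp add: blinfun.diff_left)
  qed
  then obtain R where NR: "\<And>y. ?N (R y) = y"
    by metis
  have inj: "x = x'" if "?N x = ?N x'" for x x'
  proof -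
    have "(cmod z - norm S) * norm (x - x') \<le> 0"
      using below[of "x - x'"] that by (simp only: blinfun.diff_right) simp
    then show ?thesis
      using z(1) by (simp add: mult_le_0_iff)
  qed
  have R_scaleC: "R (u *\<^sub>C y) = u *\<^sub>C R y" for u y
  proof (rule inj)
    have "?N (u *\<^sub>C R y) = u *\<^sub>C ?N (R y)"
      using N unfolding bounded_operators_def by blast
    then show "?N (R (u *\<^sub>C y)) = ?N (u *\<^sub>C R y)"
      by (simp only: NR)
  qed
  have "bounded_linear R"
  proof (rule bounded_linear_intro[where K = "1 / (cmod z - norm S)"])
    show "R (x + y) = R x + R y" for x y
      by (rule inj) (simp only: NR blinfun.add_right)
    show "R (r *\<^sub>R x) = r *\<^sub>R R x" for r x
      by (simp only: scaleR_scaleC R_scaleC)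
    show "norm (R x) \<le> norm x * (1 / (cmod z - norm S))" for x
      using below[of "R x"] z(1) by (simp only: NR) (simp add: field_simps)
  qed
  then have R: "blinfun_apply (Blinfun R) = R"
    by (rule bounded_linear_Blinfun_apply)
  have "Blinfun R \<in> bounded_operators"
    by (simp add: bounded_operators_def R R_scaleC)
  moreover have "Blinfun R o\<^sub>L ?N = id_blinfun"
    by (rule blinfun_eqI) (simp only: blinfun_apply_blinfun_compose R blinfun_apply_id_blinfun inj[OF NR] id_apply)
  moreover have "?N o\<^sub>L Blinfun R = id_blinfun"
    by (rule blinfun_eqI) (simp only: blinfun_apply_blinfun_compose R NR blinfun_apply_id_blinfun id_apply)
  ultimately show False
    using assms(2) by (auto simp: spectrum_def)
qed

lemma norm_diff_scalar_eq_SUP: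
  assumes "transloid S"
  shows "norm (S - scalar_op \<mu>) = (SUP z\<in>spectrum S. cmod (z - \<mu>))"
proof -
  have "norm (S - scalar_op \<mu>) = spectral_radius (S - scalar_op \<mu>)"
    using assms unfolding transloid_def normaloid_def by metis
  then show ?thesis
    by (simp only: spectral_radius_def spectrum_diff_scalar image_image)
qed

text \<open>
  An empty spectrum stays empty under translation. All translates \<open>S - \<mu>\<close> would then have the same
  spectral radius, whichever real number the supremum of the empty set is, and hence the same norm;
  but the norm of \<open>S - \<mu>\<close> exceeds \<open>\<parallel>S\<parallel>\<close> for large \<open>\<mu>\<close>.
\<close>

lemma spectrum_nonempty_if_transloid:
  fixes S :: "'a::complex_inner \<Rightarrow>\<^sub>L 'a"
  assumes "transloid S" "(x :: 'a) \<noteq> 0"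
  shows "spectrum S \<noteq> {}"
proof
  assume "spectrum S = {}"
  then have const: "norm (S - scalar_op \<mu>) = Sup {}" for \<mu>
    using norm_diff_scalar_eq_SUP[OF assms(1), of \<mu>] by simp
  \<comment> \<open>Any modulus above \<open>2 * norm S\<close> gives \<open>norm (S - scalar_op z) > norm S\<close>.\<close>
  define z where "z = complex_of_real (2 * norm S + 1)"
  have "cmod z = 2 * norm S + 1"
    unfolding z_def norm_of_real by simp
  then have "norm S < norm (S - scalar_op z)"
    using norm_diff_scalar_ge[OF assms(2), of z S] by simp
  then show False
    using const[of z] const[of 0] by simp
qed

text \<open>
  The norm of \<open>S - \<mu>\<close> is its spectral radius, which is the supremum of the distances from \<open>\<mu>\<close> to the
  spectrum of \<open>S\<close>. The spectrum is bounded and nonempty, so comparing this supremum with \<open>\<rho>\<close> amounts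
  to comparing every distance with \<open>\<rho>\<close>.
\<close>

lemma norm_diff_scalar_transloid:
  fixes S :: "'a::chilbert_space \<Rightarrow>\<^sub>L 'a"
  assumes "S \<in> bounded_operators" "transloid S" "(x :: 'a) \<noteq> 0"
  shows "norm (S - scalar_op \<mu>) \<le> \<rho> \<longleftrightarrow> spectrum S \<subseteq> cball \<mu> \<rho>"
proof -
  have "bdd_above ((\<lambda>z. cmod (z - \<mu>)) ` spectrum S)"
  proof (rule bdd_aboveI2)
    fix z assume "z \<in> spectrum S"
    then show "cmod (z - \<mu>) \<le> norm (S - scalar_op \<mu>)"
      by (intro cmod_le_norm_if_in_spectrum bounded_operators_diff_scalar assms(1))
         (simp add: spectrum_diff_scalar)
  qed
  then have "norm (S - scalar_op \<mu>) \<le> \<rho> \<longleftrightarrow> (\<forall>z\<in>spectrum S. cmod (z - \<mu>) \<le> \<rho>)"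
    unfolding norm_diff_scalar_eq_SUP[OF assms(2)]
    by (rule cSUP_le_iff[OF spectrum_nonempty_if_transloid[OF assms(2,3)]])
  then show ?thesis
    by (simp add: subset_eq dist_norm norm_minus_commute)
qed

text \<open>
  Scalar approximations and enclosing discs have the same centres and radii, so an optimal \<open>c\<close> for one
  problem is optimal for the other.
\<close>

lemma spectral_disc_radius_transloid:
  fixes S :: "'a::chilbert_space \<Rightarrow>\<^sub>L 'a"
  assumes "S \<in> bounded_operators" "transloid S" "(x :: 'a) \<noteq> 0"
  shows "spectral_disc_radius S = dist_scalars S"
proof -
  obtain c where c: "dist_scalars S = norm (S - scalar_op c)"
    "\<And>z. norm (S - scalar_op c) \<le> norm (S - scalar_op z)"
    using dist_scalars_attained[OF assms(3), of S] by metis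
  have smallest: "is_smallest_disc (spectrum S) c (dist_scalars S)"
    unfolding is_smallest_disc_def c(1)
    using norm_diff_scalar_transloid[OF assms] c(2) by (meson norm_ge_zero order.refl order_trans)
  show ?thesis
    unfolding spectral_disc_radius_def
    using smallest by (intro the_equality) (auto simp: is_smallest_disc_def intro: antisym)
qed

theorem proposition3p7:
  fixes A T P :: "'a::chilbert_space \<Rightarrow>\<^sub>L 'a"
  assumes "separable_space (euclidean :: 'a topology)"
    and "A \<in> bounded_operators" and "T \<in> bounded_operators"
    and "transloid A" and "transloid T"
    and "P \<in> states"
  shows "ereal (cmod (tr (P o\<^sub>L A o\<^sub>L T) - tr (P o\<^sub>L A) * tr (P o\<^sub>L T)))
           \<le> (SUP Q\<in>states. ereal (cmod (tr (Q o\<^sub>L A o\<^sub>L T) - tr (Q o\<^sub>L A) * tr (Q o\<^sub>L T))))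
       \<and> (SUP Q\<in>states. ereal (cmod (tr (Q o\<^sub>L A o\<^sub>L T) - tr (Q o\<^sub>L A) * tr (Q o\<^sub>L T))))
           \<le> ereal (dist_scalars A * dist_scalars T)
       \<and> dist_scalars A * dist_scalars T = spectral_disc_radius A * spectral_disc_radius T"
proof -
  \<comment> \<open>On the zero space every trace is \<open>0\<close>, so the state \<open>P\<close> provides a nonzero vector.\<close>
  obtain x :: 'a where x: "x \<noteq> 0"
  proof (rule ccontr)
    assume "\<not> thesis"
    then have zero: "e = 0" for e :: 'a
      using that by blast
    have "cinner (P e) e = 0" for e
      by (subst (2) zero) (rule cinner_zero_right)
    then have "tr P = 0"
      by (simp add: tr_def)
    then show False
      using assms(6) by (simp add: states_def)
  qed
  obtain a where a: "dist_scalars A = norm (A - scalar_op a)"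
    using dist_scalars_attained[OF x] by metis
  obtain t where t: "dist_scalars T = norm (T - scalar_op t)"
    using dist_scalars_attained[OF x] by metis
  have bound: "cmod (tr (Q o\<^sub>L A o\<^sub>L T) - tr (Q o\<^sub>L A) * tr (Q o\<^sub>L T))
      \<le> dist_scalars A * dist_scalars T" if "Q \<in> states" for Q
    unfolding a t by (rule covariance_state_le[OF assms(1) that assms(2,3)])
  show ?thesis
  proof (intro conjI)
    show "ereal (cmod (tr (P o\<^sub>L A o\<^sub>L T) - tr (P o\<^sub>L A) * tr (P o\<^sub>L T)))
        \<le> (SUP Q\<in>states. ereal (cmod (tr (Q o\<^sub>L A o\<^sub>L T) - tr (Q o\<^sub>L A) * tr (Q o\<^sub>L T))))"
      by (rule SUP_upper[OF assms(6)])
    show "(SUP Q\<in>states. ereal (cmod (tr (Q o\<^sub>L A o\<^sub>L T) - tr (Q o\<^sub>L A) * tr (Q o\<^sub>L T))))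
        \<le> ereal (dist_scalars A * dist_scalars T)"
      by (rule SUP_least) (simp only: ereal_less_eq bound)
    show "dist_scalars A * dist_scalars T = spectral_disc_radius A * spectral_disc_radius T"
      by (simp only: spectral_disc_radius_transloid[OF assms(2,4) x]
          spectral_disc_radius_transloid[OF assms(3,5) x])
  qed
qed

end
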